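(* Let $\mathbf P=(P,\le,{}^*,0,1)$ be a pseudocomplemented poset. Then $\mathbf{Cl}(\mathbf P)=(\mathrm{Cl}(\mathbf P),\vee,\cap,{}^\perp,\{0\},P)$ is a complete ortholattice with $\bigvee_{i\in I}A_i=(\bigcup_{i\in I}A_i)^{\perp\perp}$ and $\bigwedge_{i\in I}A_i=\bigcap_{i\in I}A_i$ for all families $(A_i)_{i\in I}$ of elements of $\mathrm{Cl}(\mathbf P)$.
   Context: A bounded poset $(P,\le,0,1)$ is pseudocomplemented if for each $x\in P$ there exists a greatest element $y\in P$ such that the infimum $x\wedge y$ exists and equals $0$; it is denoted $x^*$. The orthogonality relation is $x\perp y$ iff $y\le x^*$. For $A\subseteq P$, $A^\perp:=\{x\in P\mid x\perp y\text{ for all }y\in A\}$. A subset $A$ is closed if $A^{\perp\perp}=A$; $\mathrm{Cl}(\mathbf P)$ is the set of all closed subsets of $P$. A complete ortholattice is a complete bounded lattice with an antitone involution $'$ satisfying $x\wedge x'=0$ and $x\vee x'=1$. *)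

theory Defs
  imports "HOL-Algebra.Complete_Lattice"
begin

locale bounded_poset =
  partial_order P + weak_partial_order_bottom P + weak_partial_order_top P
  for P (structure)

definition is_pseudocomplement :: "('a, 'b) gorder_scheme \<Rightarrow> 'a \<Rightarrow> 'a \<Rightarrow> bool"
  where "is_pseudocomplement P x y \<longleftrightarrow>
    greatest P y {z \<in> carrier P. is_glb P \<bottom>\<^bsub>P\<^esub> {x, z}}"

locale pseudocomplemented_poset = bounded_poset P for P (structure) +
  assumes pseudocomplement_exists: "x \<in> carrier P \<Longrightarrow> \<exists>y. is_pseudocomplement P x y"

definition pcompl :: "('a, 'b) gorder_scheme \<Rightarrow> 'a \<Rightarrow> 'a"
  where "pcompl P x = (THE y. is_pseudocomplement P x y)"

definition orthogonal :: "('a, 'b) gorder_scheme \<Rightarrow> 'a \<Rightarrow> 'a \<Rightarrow> bool"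
  where "orthogonal P x y \<longleftrightarrow> y \<sqsubseteq>\<^bsub>P\<^esub> pcompl P x"

definition perp :: "('a, 'b) gorder_scheme \<Rightarrow> 'a set \<Rightarrow> 'a set"
  where "perp P A = {x \<in> carrier P. \<forall>y \<in> A. orthogonal P x y}"

definition closed_sets :: "('a, 'b) gorder_scheme \<Rightarrow> 'a set set"
  where "closed_sets P = {A. A \<subseteq> carrier P \<and> perp P (perp P A) = A}"

definition Cl :: "('a, 'b) gorder_scheme \<Rightarrow> 'a set gorder"
  where "Cl P = \<lparr>carrier = closed_sets P, eq = (=), le = (\<subseteq>)\<rparr>"

text \<open>Boundedness is part of \<^locale>\<open>complete_lattice\<close>, which also
  demands suprema and infima of the empty set.\<close>

locale complete_ortholattice = complete_lattice L for L (structure) +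
  fixes ortho :: "'a \<Rightarrow> 'a"
  assumes ortho_closed: "x \<in> carrier L \<Longrightarrow> ortho x \<in> carrier L"
    and ortho_antitone:
      "\<lbrakk>x \<in> carrier L; y \<in> carrier L; x \<sqsubseteq> y\<rbrakk> \<Longrightarrow> ortho y \<sqsubseteq> ortho x"
    and ortho_involution: "x \<in> carrier L \<Longrightarrow> ortho (ortho x) = x"
    and meet_ortho: "x \<in> carrier L \<Longrightarrow> x \<sqinter> ortho x = \<bottom>"
    and join_ortho: "x \<in> carrier L \<Longrightarrow> x \<squnion> ortho x = \<top>"

end

theory Submission
  imports Defs
begin

text \<open>In a pseudocomplemented poset, \<open>x \<perp> y\<close> holds iff \<open>0\<close> is the only common lower bound of
  \<open>x\<close> and \<open>y\<close>. Hence \<open>\<perp>\<close> is symmetric, \<open>0\<close> is orthogonal to everything, and only \<open>0\<close> is orthogonal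
  to itself. Symmetry makes \<open>A \<mapsto> A\<^sup>\<perp>\<close> an antitone Galois connection of the power set with itself,
  so its closed sets form a complete lattice on which \<open>\<^sup>\<perp>\<close> is an antitone involution; the last
  two properties make \<open>{0}\<close> its least element and \<open>A\<^sup>\<perp>\<close> a complement of \<open>A\<close>.\<close>

context pseudocomplemented_poset
begin

text \<open>As \<open>\<bottom>\<close> is always a lower bound, being the greatest one forces all
  others to equal it, by antisymmetry. The right-hand side is visibly symmetric in \<open>x\<close>
  and \<open>y\<close>.\<close>

lemma is_glb_bottom_iff:
  assumes "x \<in> carrier P" "y \<in> carrier P"
  shows "is_glb P \<bottom> {x, y} \<longleftrightarrow> (\<forall>z \<in> carrier P. z \<sqsubseteq> x \<and> z \<sqsubseteq> y \<longrightarrow> z = \<bottom>)"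
  using assms by (auto simp: greatest_def Lower_def intro: le_antisym)

lemma is_pseudocomplement_pcompl:
  assumes "x \<in> carrier P"
  shows "is_pseudocomplement P x (pcompl P x)"
proof -
  obtain y where y: "is_pseudocomplement P x y"
    using pseudocomplement_exists[OF assms] by blast
  show ?thesis
    unfolding pcompl_def
  proof (rule theI)
    show "is_pseudocomplement P x y" by (rule y)
    show "z = y" if "is_pseudocomplement P x z" for z
      using greatest_unique y that unfolding is_pseudocomplement_def by blast
  qed
qed

text \<open>If \<open>y\<close> lies below the pseudocomplement of \<open>x\<close>, common lower
  bounds of \<open>x\<close> and \<open>y\<close> are also common lower bounds of \<open>x\<close>
  and that pseudocomplement. Conversely, \<open>y\<close> is in the set of which the
  pseudocomplement is the greatest element.\<close>

lemma orthogonal_iff: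
  assumes x: "x \<in> carrier P" and y: "y \<in> carrier P"
  shows "orthogonal P x y \<longleftrightarrow> (\<forall>z \<in> carrier P. z \<sqsubseteq> x \<and> z \<sqsubseteq> y \<longrightarrow> z = \<bottom>)"
proof -
  let ?c = "pcompl P x"
  have g: "greatest P ?c {z \<in> carrier P. is_glb P \<bottom> {x, z}}"
    using is_pseudocomplement_pcompl[OF x] by (simp add: is_pseudocomplement_def)
  have c: "?c \<in> carrier P" and glb: "is_glb P \<bottom> {x, ?c}"
    using greatest_mem[OF g] by auto
  show ?thesis
  proof
    assume "orthogonal P x y"
    then have "y \<sqsubseteq> ?c" by (simp add: orthogonal_def)
    then show "\<forall>z \<in> carrier P. z \<sqsubseteq> x \<and> z \<sqsubseteq> y \<longrightarrow> z = \<bottom>"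
      using glb c y le_trans unfolding is_glb_bottom_iff[OF x c] by blast
  next
    assume "\<forall>z \<in> carrier P. z \<sqsubseteq> x \<and> z \<sqsubseteq> y \<longrightarrow> z = \<bottom>"
    then have "y \<in> {z \<in> carrier P. is_glb P \<bottom> {x, z}}"
      using y is_glb_bottom_iff[OF x y] by blast
    then show "orthogonal P x y"
      using greatest_le[OF g] by (simp add: orthogonal_def)
  qed
qed

lemma orthogonal_sym:
  "\<lbrakk>x \<in> carrier P; y \<in> carrier P\<rbrakk> \<Longrightarrow> orthogonal P x y \<longleftrightarrow> orthogonal P y x"
  by (auto simp: orthogonal_iff)

lemma orthogonal_self_iff: "x \<in> carrier P \<Longrightarrow> orthogonal P x x \<longleftrightarrow> x = \<bottom>"
  by (auto simp: orthogonal_iff intro: le_antisym)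

lemma orthogonal_bottom: "x \<in> carrier P \<Longrightarrow> orthogonal P x \<bottom>"
  by (auto simp: orthogonal_iff intro: le_antisym)

lemma perp_subset_carrier: "perp P A \<subseteq> carrier P"
  by (auto simp: perp_def)

lemma perp_antimono: "A \<subseteq> B \<Longrightarrow> perp P B \<subseteq> perp P A"
  by (auto simp: perp_def)

lemma subset_perp_perp: "A \<subseteq> carrier P \<Longrightarrow> A \<subseteq> perp P (perp P A)"
  using orthogonal_sym by (auto simp: perp_def)

text \<open>A triple \<open>perp\<close> equals a single one: \<open>perp\<close> reverses the
  inclusion of \<open>A\<close> in its double \<open>perp\<close>, and
  \<open>subset_perp_perp\<close> for \<open>perp P A\<close> gives the other inclusion.\<close>

lemma perp_in_closed_sets: "A \<subseteq> carrier P \<Longrightarrow> perp P A \<in> closed_sets P"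
  unfolding closed_sets_def
  using perp_antimono[OF subset_perp_perp] subset_perp_perp perp_subset_carrier
  by (metis (mono_tags, lifting) mem_Collect_eq subset_antisym)

text \<open>The double \<open>perp\<close> is monotone and fixes \<open>B\<close>.\<close>

lemma perp_perp_least:
  "\<lbrakk>A \<subseteq> B; B \<in> closed_sets P\<rbrakk> \<Longrightarrow> perp P (perp P A) \<subseteq> B"
  unfolding closed_sets_def by (metis (mono_tags, lifting) mem_Collect_eq perp_antimono)

lemma bottom_mem_perp: "A \<subseteq> carrier P \<Longrightarrow> \<bottom> \<in> perp P A"
  using orthogonal_bottom orthogonal_sym by (auto simp: perp_def)

lemma perp_bottom: "perp P {\<bottom>} = carrier P"
  using orthogonal_bottom by (auto simp: perp_def)

text \<open>An element of both sets is orthogonal to itself.\<close>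

lemma Int_perp: "A \<subseteq> carrier P \<Longrightarrow> \<bottom> \<in> A \<Longrightarrow> A \<inter> perp P A = {\<bottom>}"
  using orthogonal_self_iff bottom_mem_perp by (auto simp: perp_def)

lemma perp_carrier: "perp P (carrier P) = {\<bottom>}"
  using Int_perp[of "carrier P"] perp_subset_carrier by auto

text \<open>A closed set is itself a \<open>perp\<close>, namely that of
  \<open>perp P A\<close>.\<close>

lemma bottom_mem_closed: "A \<in> closed_sets P \<Longrightarrow> \<bottom> \<in> A"
  using bottom_mem_perp[OF perp_subset_carrier] unfolding closed_sets_def by blast

lemma carrier_closed: "carrier P \<in> closed_sets P"
  using perp_in_closed_sets[of "{\<bottom>}"] by (simp add: perp_bottom)

lemma bottom_closed_set: "{\<bottom>} \<in> closed_sets P"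
  using perp_in_closed_sets[of "carrier P"] by (simp add: perp_carrier)

text \<open>The factor \<open>carrier P\<close> makes the empty family yield the whole poset instead
  of \<open>UNIV\<close>. Closedness holds because the double \<open>perp\<close> of the
  intersection stays inside each member.\<close>

lemma Inter_closed:
  assumes "\<A> \<subseteq> closed_sets P"
  shows "carrier P \<inter> \<Inter>\<A> \<in> closed_sets P"
proof -
  let ?M = "carrier P \<inter> \<Inter>\<A>"
  have "perp P (perp P ?M) \<subseteq> A" if "A \<in> \<A>" for A
    using perp_perp_least[of ?M A] that assms by blast
  then have "perp P (perp P ?M) = ?M"
    using subset_perp_perp[of ?M] perp_subset_carrier by blast
  then show ?thesis by (simp add: closed_sets_def)
qed

lemma partial_order_Cl: "partial_order (Cl P)"
  by unfold_locales (auto simp: Cl_def)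

lemma is_lub_Cl:
  assumes "\<A> \<subseteq> closed_sets P"
  shows "is_lub (Cl P) (perp P (perp P (\<Union>\<A>))) \<A>"
proof (rule least_UpperI)
  have sub: "\<Union>\<A> \<subseteq> carrier P"
    using assms by (auto simp: closed_sets_def)
  show "A \<sqsubseteq>\<^bsub>Cl P\<^esub> perp P (perp P (\<Union>\<A>))" if "A \<in> \<A>" for A
    using subset_perp_perp[OF sub] that by (auto simp: Cl_def)
  show "perp P (perp P (\<Union>\<A>)) \<sqsubseteq>\<^bsub>Cl P\<^esub> B" if "B \<in> Upper (Cl P) \<A>" for B
    using perp_perp_least[of "\<Union>\<A>" B] that assms by (auto simp: Cl_def Upper_def)
  show "\<A> \<subseteq> carrier (Cl P)" "perp P (perp P (\<Union>\<A>)) \<in> carrier (Cl P)"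
    using assms perp_in_closed_sets[OF perp_subset_carrier] by (auto simp: Cl_def)
qed

lemma is_glb_Cl:
  assumes "\<A> \<subseteq> closed_sets P"
  shows "is_glb (Cl P) (carrier P \<inter> \<Inter>\<A>) \<A>"
proof (rule greatest_LowerI)
  show "B \<sqsubseteq>\<^bsub>Cl P\<^esub> carrier P \<inter> \<Inter>\<A>" if "B \<in> Lower (Cl P) \<A>" for B
  proof -
    have "B \<subseteq> A" if "A \<in> \<A>" for A
      using that \<open>B \<in> Lower (Cl P) \<A>\<close> assms by (auto simp: Cl_def Lower_def)
    moreover have "B \<subseteq> carrier P"
      using that by (auto simp: Cl_def Lower_def closed_sets_def)
    ultimately show ?thesis by (auto simp: Cl_def)
  qed
qed (use assms Inter_closed[OF assms] in \<open>auto simp: Cl_def\<close>)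

text \<open>The supremum is defined by Hilbert choice, so uniqueness of least elements in a partial
  order is what identifies it with the closure of the union.\<close>

lemma Sup_Cl:
  assumes "\<A> \<subseteq> closed_sets P"
  shows "\<Squnion>\<^bsub>Cl P\<^esub> \<A> = perp P (perp P (\<Union>\<A>))"
  unfolding sup_def
  by (rule some_equality, rule is_lub_Cl[OF assms])
    (rule partial_order.least_unique[OF partial_order_Cl _ is_lub_Cl[OF assms]])

lemma Inf_Cl:
  assumes "\<A> \<subseteq> closed_sets P"
  shows "\<Sqinter>\<^bsub>Cl P\<^esub> \<A> = carrier P \<inter> \<Inter>\<A>"
  unfolding inf_def
  by (rule some_equality, rule is_glb_Cl[OF assms])
    (rule partial_order.greatest_unique[OF partial_order_Cl _ is_glb_Cl[OF assms]])

lemma meet_Cl: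
  "\<lbrakk>A \<in> closed_sets P; B \<in> closed_sets P\<rbrakk> \<Longrightarrow> A \<sqinter>\<^bsub>Cl P\<^esub> B = A \<inter> B"
  by (auto simp: meet_def Inf_Cl closed_sets_def)

lemma bottom_Cl: "\<bottom>\<^bsub>Cl P\<^esub> = {\<bottom>}"
proof -
  have *: "least (Cl P) {\<bottom>} (carrier (Cl P))"
    using bottom_closed_set bottom_mem_closed by (auto simp: least_def Cl_def)
  show ?thesis
    unfolding bottom_def[of "Cl P"]
    by (rule some_equality, rule *) (rule partial_order.least_unique[OF partial_order_Cl _ *])
qed

lemma top_Cl: "\<top>\<^bsub>Cl P\<^esub> = carrier P"
proof -
  have *: "greatest (Cl P) (carrier P) (carrier (Cl P))"
    using carrier_closed by (auto simp: greatest_def Cl_def closed_sets_def)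
  show ?thesis
    unfolding top_def[of "Cl P"]
    by (rule some_equality, rule *) (rule partial_order.greatest_unique[OF partial_order_Cl _ *])
qed

lemma join_perp_Cl:
  assumes "A \<in> closed_sets P"
  shows "A \<squnion>\<^bsub>Cl P\<^esub> perp P A = carrier P"
proof -
  have A: "A \<subseteq> carrier P" using assms by (simp add: closed_sets_def)
  \<comment> \<open>\<open>perp\<close> turns unions into intersections. The result is a set meeting
    its own \<open>perp\<close>, so it collapses to \<open>{\<bottom>}\<close>; the outer
    \<open>perp\<close> in the join then gives the carrier.\<close>
  have "perp P (A \<union> perp P A) = perp P A \<inter> perp P (perp P A)"
    by (auto simp: perp_def)
  also have "\<dots> = {\<bottom>}"
    using Int_perp[OF perp_subset_carrier bottom_mem_perp[OF A]] .
  finally show ?thesis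
    using assms perp_in_closed_sets[OF A] by (simp add: join_def Sup_Cl perp_bottom)
qed

lemma complete_lattice_Cl: "complete_lattice (Cl P)"
proof -
  interpret Cl: partial_order "Cl P" by (rule partial_order_Cl)
  show ?thesis
    \<comment> \<open>The explicit bounds serve as witnesses for every subfamily, the empty one
      included.\<close>
    by unfold_locales (use is_lub_Cl is_glb_Cl in \<open>auto simp: Cl_def\<close>)
qed

lemma complete_ortholattice_Cl: "complete_ortholattice (Cl P) (perp P)"
proof (intro complete_ortholattice.intro complete_ortholattice_axioms.intro)
  show "complete_lattice (Cl P)" by (rule complete_lattice_Cl)
next
  fix A assume "A \<in> carrier (Cl P)"
  then have A: "A \<in> closed_sets P" "A \<subseteq> carrier P" "perp P (perp P A) = A"
    by (auto simp: Cl_def closed_sets_def)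
  show "perp P A \<in> carrier (Cl P)"
    using perp_in_closed_sets[OF A(2)] by (simp add: Cl_def)
  show "perp P (perp P A) = A" by (rule A(3))
  show "A \<sqinter>\<^bsub>Cl P\<^esub> perp P A = \<bottom>\<^bsub>Cl P\<^esub>"
    using A perp_in_closed_sets bottom_mem_closed by (simp add: meet_Cl bottom_Cl Int_perp)
  show "A \<squnion>\<^bsub>Cl P\<^esub> perp P A = \<top>\<^bsub>Cl P\<^esub>"
    using A by (simp add: join_perp_Cl top_Cl)
next
  fix A B assume "A \<sqsubseteq>\<^bsub>Cl P\<^esub> B"
  then show "perp P B \<sqsubseteq>\<^bsub>Cl P\<^esub> perp P A"
    using perp_antimono by (simp add: Cl_def)
qed

end

theorem theorem5:
  fixes P :: "('a, 'b) gorder_scheme"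
  assumes "pseudocomplemented_poset P"
  shows "complete_ortholattice (Cl P) (perp P)
    \<and> \<bottom>\<^bsub>Cl P\<^esub> = {\<bottom>\<^bsub>P\<^esub>}
    \<and> \<top>\<^bsub>Cl P\<^esub> = carrier P
    \<and> (\<forall>A \<in> closed_sets P. \<forall>B \<in> closed_sets P. A \<sqinter>\<^bsub>Cl P\<^esub> B = A \<inter> B)
    \<and> (\<forall>(I :: 'i set) A. (\<forall>i \<in> I. A i \<in> closed_sets P) \<longrightarrow>
         \<Squnion>\<^bsub>Cl P\<^esub> (A ` I) = perp P (perp P (\<Union>i \<in> I. A i)) \<and>
         \<Sqinter>\<^bsub>Cl P\<^esub> (A ` I) = carrier P \<inter> (\<Inter>i \<in> I. A i))"
proof -
  interpret pseudocomplemented_poset P by (rule assms)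
  show ?thesis
    \<comment> \<open>An indexed family is handled through its image;
      \<open>image_subset_iff\<close> turns closedness of each \<open>A i\<close> into the
      hypothesis of \<open>Sup_Cl\<close> and \<open>Inf_Cl\<close>.\<close>
    using complete_ortholattice_Cl bottom_Cl top_Cl meet_Cl
    by (simp add: Sup_Cl Inf_Cl image_subset_iff)
qed

end
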